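(* Every ordered vector space $V=(V,V_+)$ possesses an Archimedeanization, and this Archimedeanization is unique up to an order isomorphism. That is, the category $\mathcal{C}_{Arch}(V)$ defined in the context has an initial object $\langle U_0,\phi_0\rangle$, and the ordered vector space $U_0$ is unique up to an order isomorphism (a linear bijection that is positive in both directions).
   Context: All vector spaces are over $\mathbb{R}$, and $\mathbb{N}=\{1,2,\dots\}$. A wedge in a vector space $V$ is a subset $W$ with $W+W\subseteq W$ and $rW\subseteq W$ for all real $r\ge 0$. A cone is a wedge $K$ with $K\cap(-K)=\{0\}$ (it is not assumed to be generating). An ordered vector space (OVS) is a pair $(V,V_+)$ with $V_+$ a cone in $V$; one writes $x\le y$ iff $y-x\in V_+$. An OVS $(U,U_+)$ is Archimedean if for all $x,y\in U$: whenever $x-ny\in U_+$ for all $n\in\mathbb{N}$, then $y\in -U_+$. A linear map $\phi:V\to U$ between OVS is positive if $\phi(V_+)\subseteq U_+$. For an OVS $V=(V,V_+)$, $\mathcal{C}_{Arch}(V)$ is the category whose objects are pairs $\langle U,\phi\rangle$, where $U=(U,U_+)$ is an Archimedean OVS and $\phi:V\to U$ is a positive linear map, and whose morphisms $\langle U_1,\phi_1\rangle\to\langle U_2,\phi_2\rangle$ are positive linear maps $q:U_1\to U_2$ with $q\circ\phi_1=\phi_2$. If $\mathcal{C}_{Arch}(V)$ possesses an initial object $\langle U_0,\phi_0\rangle$, then $U_0$ is called an Archimedeanization of $V$. *)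

theory Defs
  imports Complex_Main "HOL-Library.FuncSet"
begin

text \<open>
  A vector space is given by a carrier that is a linear subspace of an ambient real vector space
  (a type of class \<^class>\<open>real_vector\<close>). No generality is lost, since the carrier may be
  the whole type. Proper subspaces are needed so that a theorem can assert the existence of a
  vector space.
\<close>

record 'a ovs =
  carrier :: "'a set"
  pos_cone :: "'a set"

definition wedge :: "'a::real_vector set \<Rightarrow> bool" where
  "wedge W \<longleftrightarrow> (\<forall>x\<in>W. \<forall>y\<in>W. x + y \<in> W) \<and> (\<forall>r\<ge>0. \<forall>x\<in>W. r *\<^sub>R x \<in> W)"

definition wedge_cone :: "'a::real_vector set \<Rightarrow> bool" where
  "wedge_cone K \<longleftrightarrow> wedge K \<and> K \<inter> uminus ` K = {0}"

definition is_ovs :: "'a::real_vector ovs \<Rightarrow> bool" where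
  "is_ovs V \<longleftrightarrow> subspace (carrier V) \<and> pos_cone V \<subseteq> carrier V \<and> wedge_cone (pos_cone V)"

definition archimedean_ovs :: "'a::real_vector ovs \<Rightarrow> bool" where
  "archimedean_ovs U \<longleftrightarrow> is_ovs U \<and>
     (\<forall>x\<in>carrier U. \<forall>y\<in>carrier U.
        (\<forall>n::nat. n \<ge> 1 \<longrightarrow> x - real n *\<^sub>R y \<in> pos_cone U) \<longrightarrow> y \<in> uminus ` pos_cone U)"

text \<open>
  Maps are extensional (\<^const>\<open>undefined\<close> off the carrier of the domain), so that equality of
  HOL functions is equality of maps between the carriers.
\<close>

definition linear_map :: "'a::real_vector ovs \<Rightarrow> 'b::real_vector ovs \<Rightarrow> ('a \<Rightarrow> 'b) \<Rightarrow> bool" where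
  "linear_map V U f \<longleftrightarrow> f \<in> carrier V \<rightarrow>\<^sub>E carrier U \<and>
     (\<forall>x\<in>carrier V. \<forall>y\<in>carrier V. f (x + y) = f x + f y) \<and>
     (\<forall>r. \<forall>x\<in>carrier V. f (r *\<^sub>R x) = r *\<^sub>R f x)"

definition positive_map :: "'a::real_vector ovs \<Rightarrow> 'b::real_vector ovs \<Rightarrow> ('a \<Rightarrow> 'b) \<Rightarrow> bool" where
  "positive_map V U f \<longleftrightarrow> linear_map V U f \<and> f ` pos_cone V \<subseteq> pos_cone U"

definition order_isomorphic :: "'a::real_vector ovs \<Rightarrow> 'b::real_vector ovs \<Rightarrow> bool" where
  "order_isomorphic U W \<longleftrightarrow>
     (\<exists>f. bij_betw f (carrier U) (carrier W) \<and> positive_map U W f \<and>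
          positive_map W U (restrict (inv_into (carrier U) f) (carrier W)))"

definition CArch_object :: "'v::real_vector ovs \<Rightarrow> 'u::real_vector ovs \<Rightarrow> ('v \<Rightarrow> 'u) \<Rightarrow> bool" where
  "CArch_object V U \<phi> \<longleftrightarrow> archimedean_ovs U \<and> positive_map V U \<phi>"

definition CArch_morphism ::
  "'v::real_vector ovs \<Rightarrow> 'a::real_vector ovs \<Rightarrow> ('v \<Rightarrow> 'a) \<Rightarrow>
   'b::real_vector ovs \<Rightarrow> ('v \<Rightarrow> 'b) \<Rightarrow> ('a \<Rightarrow> 'b) \<Rightarrow> bool" where
  "CArch_morphism V U\<^sub>1 \<phi>\<^sub>1 U\<^sub>2 \<phi>\<^sub>2 q \<longleftrightarrow>
     positive_map U\<^sub>1 U\<^sub>2 q \<and> compose (carrier V) q \<phi>\<^sub>1 = \<phi>\<^sub>2"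

text \<open>
  A HOL formula cannot quantify over types, so initiality is relative to a type \<^typ>\<open>'b\<close>: the
  target objects range over all Archimedean ordered vector spaces with carrier in \<^typ>\<open>'b\<close>.
  Being an initial object of the category means that this holds for every \<^typ>\<open>'b\<close>; the
  space \<open>U\<^sub>0\<close> is then an Archimedeanization of \<open>V\<close>. To assert that one object is initial for
  all types at once, state its existence relative to a fixed type and, separately, that initiality
  relative to that type implies initiality relative to an arbitrary \<^typ>\<open>'b\<close>; a bare
  existential over \<open>U\<^sub>0\<close> would let \<open>U\<^sub>0\<close> depend on \<^typ>\<open>'b\<close>.
\<close>

definition CArch_initial ::
  "'b::real_vector itself \<Rightarrow> 'v::real_vector ovs \<Rightarrow> 'u::real_vector ovs \<Rightarrow> ('v \<Rightarrow> 'u) \<Rightarrow> bool" where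
  "CArch_initial T V U\<^sub>0 \<phi>\<^sub>0 \<longleftrightarrow> CArch_object V U\<^sub>0 \<phi>\<^sub>0 \<and>
     (\<forall>(U :: 'b ovs) \<phi>. CArch_object V U \<phi> \<longrightarrow> (\<exists>!q. CArch_morphism V U\<^sub>0 \<phi>\<^sub>0 U \<phi> q))"

end

theory Submission imports Defs begin

text \<open>
  Let \<open>W\<close> be the least wedge in the carrier of \<open>V\<close> that contains \<open>V\<^sub>+\<close> and is Archimedean (in the
  sense that \<open>x - n y \<in> W\<close> for all \<open>n\<close> implies \<open>- y \<in> W\<close>). The preimage of the cone under any
  positive map into an Archimedean space is such a wedge, so it contains \<open>W\<close>, and the map vanishes
  on \<open>N = W \<inter> (- W)\<close>. Hence \<open>V / N\<close>, ordered by the image of \<open>W\<close>, is initial. It is realised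
  inside \<open>V\<close> as a complement of \<open>N\<close>, whose cone is its intersection with \<open>W\<close>.
\<close>

section \<open>Linear and positive maps between carriers\<close>

lemma linear_mapD:
  assumes "linear_map V U f"
  shows linear_map_extensional: "f \<in> extensional (carrier V)"
    and linear_map_closed: "x \<in> carrier V \<Longrightarrow> f x \<in> carrier U"
    and linear_map_add: "x \<in> carrier V \<Longrightarrow> y \<in> carrier V \<Longrightarrow> f (x + y) = f x + f y"
    and linear_map_scale: "x \<in> carrier V \<Longrightarrow> f (r *\<^sub>R x) = r *\<^sub>R f x"
  using assms by (auto simp: linear_map_def PiE_iff)

lemma linear_map_diff:
  assumes f: "linear_map V U f" and V: "subspace (carrier V)"
    and "x \<in> carrier V" "y \<in> carrier V"
  shows "f (x - y) = f x - f y"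
proof -
  \<comment> \<open>Additivity is available only on the carrier, so the difference is written as a
    sum whose second summand \<open>(-1) *\<^sub>R y\<close> lies there.\<close>
  have "f (x + (-1) *\<^sub>R y) = f x + (-1) *\<^sub>R f y"
    using assms subspace_scale[OF V, of y "-1"]
    by (simp only: linear_map_add[OF f] linear_map_scale[OF f])
  then show ?thesis by simp
qed

lemma positive_mapD:
  assumes "positive_map V U f"
  shows positive_map_linear: "linear_map V U f"
    and positive_map_cone: "x \<in> pos_cone V \<Longrightarrow> f x \<in> pos_cone U"
  using assms by (auto simp: positive_map_def)

lemma positive_map_compose:
  assumes f: "positive_map V U f" and g: "positive_map U W g"
    and V: "is_ovs V"
  shows "positive_map V W (compose (carrier V) g f)"
proof -
  have sub: "subspace (carrier V)" and cone: "pos_cone V \<subseteq> carrier V"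
    using V by (auto simp: is_ovs_def)
  note F = linear_mapD[OF positive_map_linear[OF f]]
  note G = linear_mapD[OF positive_map_linear[OF g]]
  have "linear_map V W (compose (carrier V) g f)"
    unfolding linear_map_def
    using sub by (auto simp: compose_def F G subspace_add subspace_scale)
  moreover have "compose (carrier V) g f ` pos_cone V \<subseteq> pos_cone W"
    using cone by (auto simp: compose_def subset_iff positive_map_cone[OF f] positive_map_cone[OF g])
  ultimately show ?thesis
    by (simp add: positive_map_def)
qed

text \<open>The identity is restricted to the carrier because linear maps are required to be
  extensional.\<close>

lemma positive_map_id:
  assumes "is_ovs V"
  shows "positive_map V V (restrict id (carrier V))"
  using assms
  by (auto simp: is_ovs_def positive_map_def linear_map_def subset_iff subspace_add subspace_scale)

section \<open>Identities and composition in the category\<close>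

lemma CArch_objectD:
  assumes "CArch_object V U \<phi>"
  shows CArch_object_archimedean: "archimedean_ovs U"
    and CArch_object_ovs: "is_ovs U"
    and CArch_object_map: "positive_map V U \<phi>"
  using assms by (auto simp: CArch_object_def archimedean_ovs_def)

lemma CArch_morphism_id:
  assumes "CArch_object V U \<phi>"
  shows "CArch_morphism V U \<phi> U \<phi> (restrict id (carrier U))"
proof -
  note P = linear_mapD[OF positive_map_linear[OF CArch_object_map[OF assms]]]
  have "compose (carrier V) (restrict id (carrier U)) \<phi> = \<phi>"
    by (rule extensionalityI[OF compose_extensional]) (auto simp: compose_def P)
  then show ?thesis
    using positive_map_id[OF CArch_object_ovs[OF assms]] by (simp add: CArch_morphism_def)
qed

lemma CArch_morphism_compose:
  assumes ob: "CArch_object V U\<^sub>1 \<phi>\<^sub>1"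
    and q: "CArch_morphism V U\<^sub>1 \<phi>\<^sub>1 U\<^sub>2 \<phi>\<^sub>2 q" and r: "CArch_morphism V U\<^sub>2 \<phi>\<^sub>2 U\<^sub>3 \<phi>\<^sub>3 r"
  shows "CArch_morphism V U\<^sub>1 \<phi>\<^sub>1 U\<^sub>3 \<phi>\<^sub>3 (compose (carrier U\<^sub>1) r q)"
proof -
  \<comment> \<open>Associativity of \<open>compose\<close> depends on the first map landing in the
    set to which the inner composite is restricted.\<close>
  have "\<phi>\<^sub>1 \<in> carrier V \<rightarrow> carrier U\<^sub>1"
    using linear_map_closed[OF positive_map_linear[OF CArch_object_map[OF ob]]] by auto
  then have "compose (carrier V) (compose (carrier U\<^sub>1) r q) \<phi>\<^sub>1
      = compose (carrier V) r (compose (carrier V) q \<phi>\<^sub>1)"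
    using compose_assoc by metis
  then show ?thesis
    using q r positive_map_compose[OF _ _ CArch_object_ovs[OF ob]]
    by (auto simp: CArch_morphism_def)
qed

section \<open>Initial objects: uniqueness and change of target type\<close>

lemma CArch_initialD:
  assumes "CArch_initial TYPE('b::real_vector) V U\<^sub>0 \<phi>\<^sub>0"
  shows CArch_initial_object: "CArch_object V U\<^sub>0 \<phi>\<^sub>0"
    and CArch_initial_ex1:
      "CArch_object V (U :: 'b ovs) \<phi> \<Longrightarrow> \<exists>!q. CArch_morphism V U\<^sub>0 \<phi>\<^sub>0 U \<phi> q"
  using assms unfolding CArch_initial_def by blast+

text \<open>Each composite is an endomorphism of an initial object, hence equals the identity.
  Initiality is relative to a type, so each of the two objects must be initial both for its own type
  (endomorphisms) and for that of the other (the maps \<open>q\<close> and \<open>r\<close>), which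
  accounts for the four assumptions.\<close>

lemma CArch_initial_inverse_morphisms:
  fixes U\<^sub>1 :: "'b::real_vector ovs" and U\<^sub>2 :: "'c::real_vector ovs"
  assumes "CArch_initial TYPE('b) V U\<^sub>1 \<phi>\<^sub>1" and "CArch_initial TYPE('c) V U\<^sub>1 \<phi>\<^sub>1"
    and "CArch_initial TYPE('b) V U\<^sub>2 \<phi>\<^sub>2" and "CArch_initial TYPE('c) V U\<^sub>2 \<phi>\<^sub>2"
  obtains q r where "CArch_morphism V U\<^sub>1 \<phi>\<^sub>1 U\<^sub>2 \<phi>\<^sub>2 q" and "CArch_morphism V U\<^sub>2 \<phi>\<^sub>2 U\<^sub>1 \<phi>\<^sub>1 r"
    and "\<forall>x\<in>carrier U\<^sub>1. r (q x) = x" and "\<forall>y\<in>carrier U\<^sub>2. q (r y) = y"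
proof -
  have ob1: "CArch_object V U\<^sub>1 \<phi>\<^sub>1" and ob2: "CArch_object V U\<^sub>2 \<phi>\<^sub>2"
    using assms CArch_initial_object by blast+
  obtain q where q: "CArch_morphism V U\<^sub>1 \<phi>\<^sub>1 U\<^sub>2 \<phi>\<^sub>2 q"
    using CArch_initial_ex1[OF assms(2) ob2] by blast
  obtain r where r: "CArch_morphism V U\<^sub>2 \<phi>\<^sub>2 U\<^sub>1 \<phi>\<^sub>1 r"
    using CArch_initial_ex1[OF assms(3) ob1] by blast
  have "compose (carrier U\<^sub>1) r q = restrict id (carrier U\<^sub>1)"
    using CArch_initial_ex1[OF assms(1) ob1] CArch_morphism_compose[OF ob1 q r]
      CArch_morphism_id[OF ob1] by blast
  then have rq: "r (q x) = x" if "x \<in> carrier U\<^sub>1" for x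
    using that by (metis compose_eq restrict_apply' id_apply)
  have "compose (carrier U\<^sub>2) q r = restrict id (carrier U\<^sub>2)"
    using CArch_initial_ex1[OF assms(4) ob2] CArch_morphism_compose[OF ob2 r q]
      CArch_morphism_id[OF ob2] by blast
  then have qr: "q (r y) = y" if "y \<in> carrier U\<^sub>2" for y
    using that by (metis compose_eq restrict_apply' id_apply)
  show thesis
    using that q r rq qr by blast
qed

lemma CArch_initial_order_isomorphic:
  fixes U\<^sub>1 :: "'b::real_vector ovs" and U\<^sub>2 :: "'c::real_vector ovs"
  assumes "CArch_initial TYPE('b) V U\<^sub>1 \<phi>\<^sub>1" and "CArch_initial TYPE('c) V U\<^sub>1 \<phi>\<^sub>1"
    and "CArch_initial TYPE('b) V U\<^sub>2 \<phi>\<^sub>2" and "CArch_initial TYPE('c) V U\<^sub>2 \<phi>\<^sub>2"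
  shows "order_isomorphic U\<^sub>1 U\<^sub>2"
proof -
  obtain q r where q: "CArch_morphism V U\<^sub>1 \<phi>\<^sub>1 U\<^sub>2 \<phi>\<^sub>2 q" and r: "CArch_morphism V U\<^sub>2 \<phi>\<^sub>2 U\<^sub>1 \<phi>\<^sub>1 r"
    and rq: "\<forall>x\<in>carrier U\<^sub>1. r (q x) = x" and qr: "\<forall>y\<in>carrier U\<^sub>2. q (r y) = y"
    by (rule CArch_initial_inverse_morphisms[OF assms])
  have pq: "positive_map U\<^sub>1 U\<^sub>2 q" and pr: "positive_map U\<^sub>2 U\<^sub>1 r"
    using q r by (auto simp: CArch_morphism_def)
  note Q = linear_mapD[OF positive_map_linear[OF pq]]
  note R = linear_mapD[OF positive_map_linear[OF pr]]
  have bij: "bij_betw q (carrier U\<^sub>1) (carrier U\<^sub>2)"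
    by (rule bij_betw_byWitness[where f' = r]) (auto simp: rq qr Q R)
  \<comment> \<open>An order isomorphism is stated through the restricted set-theoretic inverse.
    Since \<open>r\<close> is extensional and inverts \<open>q\<close>, it is that very function,
    and so its positivity carries over.\<close>
  have "restrict (inv_into (carrier U\<^sub>1) q) (carrier U\<^sub>2) = r"
  proof (rule extensionalityI[OF restrict_extensional R(1)])
    fix y assume "y \<in> carrier U\<^sub>2"
    then show "restrict (inv_into (carrier U\<^sub>1) q) (carrier U\<^sub>2) y = r y"
      by (auto intro: inv_into_f_eq[OF bij_betw_imp_inj_on[OF bij]] simp: qr R)
  qed
  then show ?thesis
    using bij pq pr unfolding order_isomorphic_def by metis
qed

text \<open>Initiality for a further type \<open>'b\<close> is carried along the isomorphism between
  \<open>U\<^sub>1\<close> and \<open>U\<^sub>2\<close>. It therefore suffices to know it for one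
  particular initial object, such as an explicitly constructed one.\<close>

lemma CArch_initial_transfer:
  fixes U\<^sub>1 :: "'u::real_vector ovs" and U\<^sub>2 :: "'w::real_vector ovs"
  assumes "CArch_initial TYPE('u) V U\<^sub>1 \<phi>\<^sub>1" and "CArch_initial TYPE('w) V U\<^sub>1 \<phi>\<^sub>1"
    and "CArch_initial TYPE('u) V U\<^sub>2 \<phi>\<^sub>2" and "CArch_initial TYPE('w) V U\<^sub>2 \<phi>\<^sub>2"
    and b: "CArch_initial TYPE('b::real_vector) V U\<^sub>1 \<phi>\<^sub>1"
  shows "CArch_initial TYPE('b) V U\<^sub>2 \<phi>\<^sub>2"
  unfolding CArch_initial_def
proof (intro conjI allI impI)
  have ob1: "CArch_object V U\<^sub>1 \<phi>\<^sub>1" using b by (rule CArch_initial_object)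
  show ob2: "CArch_object V U\<^sub>2 \<phi>\<^sub>2" using assms(3) by (rule CArch_initial_object)
  obtain q r where q: "CArch_morphism V U\<^sub>1 \<phi>\<^sub>1 U\<^sub>2 \<phi>\<^sub>2 q" and r: "CArch_morphism V U\<^sub>2 \<phi>\<^sub>2 U\<^sub>1 \<phi>\<^sub>1 r"
    and "\<forall>x\<in>carrier U\<^sub>1. r (q x) = x" and qr: "\<forall>y\<in>carrier U\<^sub>2. q (r y) = y"
    by (rule CArch_initial_inverse_morphisms[OF assms(1-4)])
  have r_closed: "r y \<in> carrier U\<^sub>1" if "y \<in> carrier U\<^sub>2" for y
    using r that linear_map_closed positive_map_linear by (metis CArch_morphism_def)
  fix U :: "'b ovs" and \<phi> assume ob: "CArch_object V U \<phi>"
  obtain s where s: "CArch_morphism V U\<^sub>1 \<phi>\<^sub>1 U \<phi> s"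
    using CArch_initial_ex1[OF b ob] by blast
  show "\<exists>!t. CArch_morphism V U\<^sub>2 \<phi>\<^sub>2 U \<phi> t"
  proof (rule ex1I)
    show "CArch_morphism V U\<^sub>2 \<phi>\<^sub>2 U \<phi> (compose (carrier U\<^sub>2) s r)"
      using CArch_morphism_compose[OF ob2 r s] .
    fix t assume t: "CArch_morphism V U\<^sub>2 \<phi>\<^sub>2 U \<phi> t"
    \<comment> \<open>Precomposing with \<open>q\<close> reduces uniqueness of \<open>t\<close> to
      uniqueness of \<open>s\<close>; then t = t q r = s r.\<close>
    have "compose (carrier U\<^sub>1) t q = s"
      using CArch_initial_ex1[OF b ob] CArch_morphism_compose[OF ob1 q t] s by blast
    then have eq: "t (q x) = s x" if "x \<in> carrier U\<^sub>1" for x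
      using that by (metis compose_eq)
    show "t = compose (carrier U\<^sub>2) s r"
    proof (rule extensionalityI[OF _ compose_extensional])
      show "t \<in> extensional (carrier U\<^sub>2)"
        using t linear_map_extensional positive_map_linear by (metis CArch_morphism_def)
      fix y assume "y \<in> carrier U\<^sub>2"
      then show "t y = compose (carrier U\<^sub>2) s r y"
        using eq[of "r y"] by (simp add: r_closed qr compose_eq)
    qed
  qed
qed

section \<open>The Archimedean hull of the positive cone\<close>

definition archimedean_wedge :: "'a::real_vector ovs \<Rightarrow> 'a set \<Rightarrow> bool" where
  "archimedean_wedge V W \<longleftrightarrow> wedge W \<and> pos_cone V \<subseteq> W \<and> W \<subseteq> carrier V \<and>
     (\<forall>x\<in>carrier V. \<forall>y\<in>carrier V. (\<forall>n::nat. n \<ge> 1 \<longrightarrow> x - real n *\<^sub>R y \<in> W) \<longrightarrow> - y \<in> W)"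

text \<open>For an ordered vector space the intersected family contains \<open>carrier V\<close>, so
  the intersection stays inside the carrier.\<close>

definition archimedean_hull :: "'a::real_vector ovs \<Rightarrow> 'a set" where
  "archimedean_hull V = \<Inter>{W. archimedean_wedge V W}"

lemma archimedean_wedge_carrier:
  assumes "is_ovs V"
  shows "archimedean_wedge V (carrier V)"
  using assms
  by (auto simp: archimedean_wedge_def wedge_def is_ovs_def subspace_add subspace_scale subspace_neg)

text \<open>All conditions except inclusion in the carrier pass to arbitrary intersections; that
  inclusion comes from the carrier being a member of the family.\<close>

lemma archimedean_wedge_hull:
  assumes "is_ovs V"
  shows "archimedean_wedge V (archimedean_hull V)"
proof -
  have "archimedean_hull V \<subseteq> carrier V"
    using archimedean_wedge_carrier[OF assms] by (auto simp: archimedean_hull_def)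
  then show ?thesis
    unfolding archimedean_wedge_def[of V "archimedean_hull V"]
    by (auto simp: archimedean_hull_def archimedean_wedge_def wedge_def)
qed

lemma archimedean_ovsD:
  assumes "archimedean_ovs U" and "x \<in> carrier U" "y \<in> carrier U"
    and "\<And>n::nat. n \<ge> 1 \<Longrightarrow> x - real n *\<^sub>R y \<in> pos_cone U"
  shows "- y \<in> pos_cone U"
proof -
  have "y \<in> uminus ` pos_cone U"
    using assms by (simp add: archimedean_ovs_def)
  then show ?thesis by force
qed

text \<open>By minimality of the hull it is enough that the preimage \<open>?W\<close> of the cone
  is one of the intersected wedges. Its Archimedean condition is pulled back from \<open>U\<close>
  along \<phi>(x - n y) = \<phi>(x) - n \<phi>(y).\<close>

lemma archimedean_hull_positive:
  assumes V: "is_ovs V" and ob: "CArch_object V U \<phi>" and x: "x \<in> archimedean_hull V"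
  shows "\<phi> x \<in> pos_cone U"
proof -
  have sub: "subspace (carrier V)" and cone: "pos_cone V \<subseteq> carrier V"
    using V by (auto simp: is_ovs_def)
  have W: "wedge (pos_cone U)"
    using CArch_object_ovs[OF ob] by (simp add: is_ovs_def wedge_cone_def)
  note pos = CArch_object_map[OF ob]
  note lin = positive_map_linear[OF pos]
  let ?W = "{x \<in> carrier V. \<phi> x \<in> pos_cone U}"
  have "archimedean_wedge V ?W"
    unfolding archimedean_wedge_def
  proof (intro conjI ballI impI)
    show "wedge ?W"
      using W sub
      by (auto simp: wedge_def linear_map_add[OF lin] linear_map_scale[OF lin]
          subspace_add subspace_scale)
    show "pos_cone V \<subseteq> ?W"
      using cone positive_map_cone[OF pos] by auto
    fix x y assume xy: "x \<in> carrier V" "y \<in> carrier V"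
      and n: "\<forall>n::nat. n \<ge> 1 \<longrightarrow> x - real n *\<^sub>R y \<in> ?W"
    have "\<phi> (x - real n *\<^sub>R y) = \<phi> x - real n *\<^sub>R \<phi> y" for n
      using xy sub by (simp add: linear_map_diff[OF lin] linear_map_scale[OF lin] subspace_scale)
    with n have "- \<phi> y \<in> pos_cone U"
      using archimedean_ovsD[OF CArch_object_archimedean[OF ob], of "\<phi> x" "\<phi> y"]
        xy linear_map_closed[OF lin] by auto
    moreover have "\<phi> (- y) = - \<phi> y"
      using linear_map_scale[OF lin xy(2), of "-1"] by simp
    ultimately show "- y \<in> ?W"
      using xy sub by (simp add: subspace_neg)
  qed auto
  then show ?thesis
    using x by (auto simp: archimedean_hull_def)
qed

section \<open>The quotient by the lineality space\<close>

lemma subspace_wedge_lineality: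
  assumes W: "wedge W" and 0: "0 \<in> W"
  shows "subspace {x. x \<in> W \<and> - x \<in> W}"
proof (rule subspaceI)
  fix c :: real and x assume x: "x \<in> {x. x \<in> W \<and> - x \<in> W}"
  have scale: "r *\<^sub>R y \<in> W" if "0 \<le> r" "y \<in> W" for r y
    using W that by (simp add: wedge_def)
  show "c *\<^sub>R x \<in> {x. x \<in> W \<and> - x \<in> W}"
    \<comment> \<open>For negative c the scalar -c is admissible, and x and -x exchange
      roles.\<close>
    using x scale[of c x] scale[of c "- x"] scale[of "- c" x] scale[of "- c" "- x"]
    by (cases "0 \<le> c") auto
next
  fix x y assume xy: "x \<in> {x. x \<in> W \<and> - x \<in> W}" "y \<in> {x. x \<in> W \<and> - x \<in> W}"
  then have "- x + - y \<in> W" and "x + y \<in> W"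
    using W unfolding wedge_def by blast+
  then show "x + y \<in> {x. x \<in> W \<and> - x \<in> W}" by simp
qed (use 0 in simp)

text \<open>Both initiality claims concern the same object, whose construction does not mention
  \<open>'b\<close>; this is what allows a later transfer to other initial objects.\<close>

lemma CArch_initial_quotient:
  fixes V :: "'a::real_vector ovs"
  assumes V: "is_ovs V"
  obtains U\<^sub>0 :: "'a ovs" and \<phi>\<^sub>0
  where "CArch_initial TYPE('a) V U\<^sub>0 \<phi>\<^sub>0" and "CArch_initial TYPE('b::real_vector) V U\<^sub>0 \<phi>\<^sub>0"
proof -
  define C where "C = carrier V"
  define W where "W = archimedean_hull V"
  define N where "N = {x. x \<in> W \<and> - x \<in> W}"
  have aw: "archimedean_wedge V W"
    unfolding W_def by (rule archimedean_wedge_hull[OF V])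
  have sub: "subspace C" and KC: "pos_cone V \<subseteq> C" and K0: "0 \<in> pos_cone V"
    using V by (auto simp: is_ovs_def wedge_cone_def C_def)
  have W: "wedge W" and KW: "pos_cone V \<subseteq> W" and WC: "W \<subseteq> C"
    and arch: "\<And>x y. \<lbrakk>x \<in> C; y \<in> C; \<And>n::nat. n \<ge> 1 \<Longrightarrow> x - real n *\<^sub>R y \<in> W\<rbrakk> \<Longrightarrow> - y \<in> W"
    using aw by (auto simp: archimedean_wedge_def C_def)
  have W0: "0 \<in> W" using KW K0 by auto
  have N: "subspace N"
    unfolding N_def using subspace_wedge_lineality[OF W W0] .
  \<comment> \<open>A linear left inverse of the identity on \<open>N\<close> is a linear projection
    of the ambient space onto \<open>N\<close>.\<close>
  obtain g :: "'a \<Rightarrow> 'a" where g: "linear g" "range g \<subseteq> N" "\<And>v. v \<in> N \<Longrightarrow> g v = v"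
    using linear_exists_left_inverse_on[OF linear_ident N] by (auto simp: inj_on_def)
  have gN: "g x \<in> N" for x using g(2) by auto
  have NC: "N \<subseteq> C" using WC by (auto simp: N_def)
  have gg: "g (g x) = g x" for x by (simp add: g(3) gN)
  \<comment> \<open>The kernel of \<open>g\<close> in \<open>C\<close> is a complement of
    \<open>N\<close> and models C / N, with x - g x representing the class of x. Thus
    \<open>\<phi>\<^sub>0\<close> plays the quotient map.\<close>
  define D where "D = {x \<in> C. g x = 0}"
  define U\<^sub>0 where "U\<^sub>0 = \<lparr>carrier = D, pos_cone = W \<inter> D\<rparr>"
  define \<phi>\<^sub>0 where "\<phi>\<^sub>0 = (\<lambda>x\<in>C. x - g x)"
  have D: "subspace D"
    using sub by (auto simp: D_def subspace_def linear_add[OF g(1)] linear_scale[OF g(1)] linear_0[OF g(1)])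
  have DC: "D \<subseteq> C" by (auto simp: D_def)
  have proj: "x - g x \<in> D" if "x \<in> C" for x
    using that NC gN sub by (auto simp: D_def linear_diff[OF g(1)] gg subspace_diff subset_iff)
  \<comment> \<open>Such an x lies in \<open>N\<close>, where \<open>g\<close> is the identity, and
    in the kernel of \<open>g\<close>.\<close>
  have "x = 0" if "x \<in> W" "- x \<in> W" "x \<in> D" for x
    using that g(3)[of x] by (simp add: N_def D_def)
  then have "wedge_cone (W \<inter> D)"
    using W W0 D subspace_neg[OF D]
    by (auto simp: wedge_cone_def wedge_def subspace_add subspace_scale subspace_0 image_iff)
  then have U0: "is_ovs U\<^sub>0"
    using D by (simp add: is_ovs_def U\<^sub>0_def)
  have "- y \<in> W \<inter> D" if "x \<in> D" "y \<in> D" "\<forall>n::nat. n \<ge> 1 \<longrightarrow> x - real n *\<^sub>R y \<in> W \<inter> D" for x y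
    using that arch[of x y] DC subspace_neg[OF D] by auto
  then have arch0: "archimedean_ovs U\<^sub>0"
    unfolding archimedean_ovs_def using U0 by (force simp: U\<^sub>0_def)
  \<comment> \<open>As g x lies in \<open>N\<close>, its negative lies in \<open>W\<close>, so
    subtracting it is addition within the wedge. Hence the cone \<open>W \<inter> D\<close> is the
    image of \<open>W\<close>.\<close>
  have projW: "x - g x \<in> W" if "x \<in> W" for x
    using that W gN[of x] by (force simp: wedge_def N_def)
  have "positive_map V U\<^sub>0 \<phi>\<^sub>0"
    using proj sub KC KW projW
    by (auto simp: positive_map_def linear_map_def \<phi>\<^sub>0_def U\<^sub>0_def C_def[symmetric] subspace_add
        subspace_scale linear_add[OF g(1)] linear_scale[OF g(1)] scaleR_diff_right subset_iff)
  then have ob0: "CArch_object V U\<^sub>0 \<phi>\<^sub>0"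
    using arch0 by (simp add: CArch_object_def)
  \<comment> \<open>The type \<open>'x\<close> is left free so that the fact can be instantiated at
    both \<open>'a\<close> and \<open>'b\<close>.\<close>
  have univ: "\<exists>!q. CArch_morphism V U\<^sub>0 \<phi>\<^sub>0 U \<phi> q" if ob: "CArch_object V U \<phi>"
    for U :: "'x::real_vector ovs" and \<phi>
  proof -
    have lin: "linear_map V U \<phi>" and pos: "positive_map V U \<phi>"
      using ob by (auto simp: CArch_object_def positive_map_def)
    have cone: "pos_cone U \<inter> uminus ` pos_cone U = {0}"
      using CArch_object_ovs[OF ob] by (simp add: is_ovs_def wedge_cone_def)
    have posW: "\<phi> x \<in> pos_cone U" if "x \<in> W" for x
      using archimedean_hull_positive[OF V ob] that by (simp add: W_def)
    \<comment> \<open>On \<open>N\<close> both \<phi>(x) and its negative lie in the cone of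
      \<open>U\<close>, which meets its negative only in 0.\<close>
    have zero: "\<phi> x = 0" if "x \<in> N" for x
    proof -
      have "x \<in> carrier V" using that NC by (auto simp: C_def)
      then have "\<phi> (- x) = - \<phi> x"
        using linear_map_scale[OF lin, of x "-1"] by simp
      then have "\<phi> x \<in> pos_cone U" "- \<phi> x \<in> pos_cone U"
        using that posW[of x] posW[of "- x"] by (auto simp: N_def)
      then show ?thesis using cone by (force simp: image_iff)
    qed
    \<comment> \<open>So \<phi> factors through the projection, and its restriction to
      \<open>D\<close> is the required morphism.\<close>
    have proj_eq: "\<phi> (x - g x) = \<phi> x" if "x \<in> C" for x
      using that gN[of x] NC sub zero linear_map_diff[OF lin, of x "g x"] by (auto simp: C_def)
    show ?thesis
    proof (rule ex1I)
      have "positive_map U\<^sub>0 U (restrict \<phi> D)"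
        using DC D posW linear_mapD[OF lin]
        by (auto simp: positive_map_def linear_map_def U\<^sub>0_def C_def subset_iff
            subspace_add subspace_scale)
      moreover have "compose (carrier V) (restrict \<phi> D) \<phi>\<^sub>0 = \<phi>"
        by (rule extensionalityI[OF compose_extensional linear_map_extensional[OF lin]])
          (simp add: compose_eq \<phi>\<^sub>0_def C_def[symmetric] proj proj_eq)
      ultimately show "CArch_morphism V U\<^sub>0 \<phi>\<^sub>0 U \<phi> (restrict \<phi> D)"
        by (simp add: CArch_morphism_def)
      fix q assume q: "CArch_morphism V U\<^sub>0 \<phi>\<^sub>0 U \<phi> q"
      show "q = restrict \<phi> D"
      proof (rule extensionalityI[OF _ restrict_extensional])
        show "q \<in> extensional D"
          using q linear_map_extensional[of U\<^sub>0 U q]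
          by (simp add: CArch_morphism_def positive_map_def U\<^sub>0_def)
        fix x assume x: "x \<in> D"
        \<comment> \<open>Uniqueness: \<open>\<phi>\<^sub>0\<close> fixes \<open>D\<close>
          pointwise, so the commuting triangle prescribes q on all of \<open>D\<close>.\<close>
        then have "x \<in> carrier V" and "\<phi>\<^sub>0 x = x"
          using DC by (auto simp: D_def \<phi>\<^sub>0_def C_def)
        then have "q x = \<phi> x"
          using q compose_eq[of x "carrier V" q \<phi>\<^sub>0] by (simp add: CArch_morphism_def)
        then show "q x = restrict \<phi> D x" using x by simp
      qed
    qed
  qed
  have "CArch_initial TYPE('a) V U\<^sub>0 \<phi>\<^sub>0"
    unfolding CArch_initial_def by (intro conjI allI impI ob0 univ)
  moreover have "CArch_initial TYPE('b) V U\<^sub>0 \<phi>\<^sub>0"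
    unfolding CArch_initial_def by (intro conjI allI impI ob0 univ)
  ultimately show thesis by (rule that)
qed

theorem theorem1:
  fixes V :: "'a::real_vector ovs"
  assumes "is_ovs V"
  shows
    "(\<exists>(U\<^sub>0 :: 'a ovs) \<phi>\<^sub>0. CArch_initial TYPE('a) V U\<^sub>0 \<phi>\<^sub>0) \<and>
     (\<forall>(U\<^sub>0 :: 'a ovs) \<phi>\<^sub>0.
        CArch_initial TYPE('a) V U\<^sub>0 \<phi>\<^sub>0 \<longrightarrow> CArch_initial TYPE('b::real_vector) V U\<^sub>0 \<phi>\<^sub>0) \<and>
     (\<forall>(U\<^sub>1 :: 'b ovs) \<phi>\<^sub>1 (U\<^sub>2 :: 'c::real_vector ovs) \<phi>\<^sub>2.
        CArch_initial TYPE('b) V U\<^sub>1 \<phi>\<^sub>1 \<and> CArch_initial TYPE('c) V U\<^sub>1 \<phi>\<^sub>1 \<and>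
        CArch_initial TYPE('b) V U\<^sub>2 \<phi>\<^sub>2 \<and> CArch_initial TYPE('c) V U\<^sub>2 \<phi>\<^sub>2 \<longrightarrow>
        order_isomorphic U\<^sub>1 U\<^sub>2)"
proof (intro conjI allI impI)
  obtain U\<^sub>1 :: "'a ovs" and \<phi>\<^sub>1
    where a: "CArch_initial TYPE('a) V U\<^sub>1 \<phi>\<^sub>1" and b: "CArch_initial TYPE('b) V U\<^sub>1 \<phi>\<^sub>1"
    using CArch_initial_quotient[OF assms] .
  show "\<exists>(U\<^sub>0 :: 'a ovs) \<phi>\<^sub>0. CArch_initial TYPE('a) V U\<^sub>0 \<phi>\<^sub>0"
    using a by (intro exI)
  fix U\<^sub>0 :: "'a ovs" and \<phi>\<^sub>0 assume "CArch_initial TYPE('a) V U\<^sub>0 \<phi>\<^sub>0"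
  \<comment> \<open>An arbitrary \<open>U\<^sub>0\<close> is known to be initial only for
    \<open>'a\<close>; it is compared there with the constructed \<open>U\<^sub>1\<close>, which is
    initial for \<open>'b\<close> as well.\<close>
  with a show "CArch_initial TYPE('b) V U\<^sub>0 \<phi>\<^sub>0"
    using CArch_initial_transfer[OF a a _ _ b] by blast
next
  fix U\<^sub>1 :: "'b ovs" and \<phi>\<^sub>1 and U\<^sub>2 :: "'c ovs" and \<phi>\<^sub>2
  assume "CArch_initial TYPE('b) V U\<^sub>1 \<phi>\<^sub>1 \<and> CArch_initial TYPE('c) V U\<^sub>1 \<phi>\<^sub>1 \<and>
    CArch_initial TYPE('b) V U\<^sub>2 \<phi>\<^sub>2 \<and> CArch_initial TYPE('c) V U\<^sub>2 \<phi>\<^sub>2"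
  then show "order_isomorphic U\<^sub>1 U\<^sub>2"
    by (elim conjE) (rule CArch_initial_order_isomorphic)
qed

end
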